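(* Let $G$ be a finite simple graph and let $f$ be a Morse function on $G$. For $k\ge 0$ let $b_k$ be the $k$-th Betti number of $G$ and let $c_k$ be the number of critical points of $f$ of Morse index $k$. Then the weak Morse inequalities hold: $b_k\le c_k$ for all $k\ge 0$.
   Context: For a vertex $x$ of a finite simple graph $G=(V,E)$, the unit sphere $S(x)$ is the subgraph generated (induced) by all vertices directly connected to $x$. For $f:V\to\mathbb{R}$, $S^-_f(x)$ is the subgraph generated by the vertices $y\in S(x)$ with $f(y)<f(x)$. Contractible graphs (inductive definition): the one-vertex graph is contractible; a finite simple graph $G=(V,E)$ is contractible if there exists a vertex $v$ such that both $S(v)$ and the graph generated by $V\setminus\{v\}$ are contractible. Evako spheres (inductive definition): the empty graph is the $(-1)$-sphere. For $k\ge0$, a $k$-graph is a finite simple graph for which every unit sphere is a $(k-1)$-sphere. A $k$-sphere is a $k$-graph which becomes contractible after removing some vertex. A function $f:V\to\mathbb{R}$ is a Morse function if it is locally injective ($f(x)\ne f(y)$ whenever $x,y$ are adjacent) and for every vertex $x$ the graph $S^-_f(x)$ is an $m$-sphere for some $m=m_x\ge -1$. Every vertex $x$ is then a critical point, and its Morse index is $m_x+1$ (so the Morse index is $0$ if $S^-_f(x)$ is empty). The Betti number $b_k$ is the dimension of the $k$-th simplicial cohomology group $H^k(G)$ with real coefficients of the Whitney complex of $G$ (whose simplices are the vertex sets of the nonempty complete subgraphs of $G$). *)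

theory Defs
  imports
    "Graph_Theory.Graph_Theory"
    "Jordan_Normal_Form.VS_Connect"
    "HOL-Algebra.AbelCoset"
    "HOL-Combinatorics.Permutations"
begin

section \<open>Spheres and Morse functions on finite simple graphs\<close>

text \<open>
  A finite simple graph is a digraph satisfying the library predicate \<^const>\<open>graph\<close>: finite, loop-free,
  without parallel arcs, and with a symmetric arc relation. An undirected edge is a pair of opposite
  arcs.
\<close>

definition unit_sphere :: "('a, 'b) pre_digraph \<Rightarrow> 'a \<Rightarrow> ('a, 'b) pre_digraph" where
  "unit_sphere G x = G \<restriction> {y. x \<rightarrow>\<^bsub>G\<^esub> y}"

definition lower_sphere :: "('a, 'b) pre_digraph \<Rightarrow> ('a \<Rightarrow> real) \<Rightarrow> 'a \<Rightarrow> ('a, 'b) pre_digraph" where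
  "lower_sphere G f x = G \<restriction> {y \<in> verts (unit_sphere G x). f y < f x}"

inductive contractible_graph :: "('a, 'b) pre_digraph \<Rightarrow> bool" where
  one_vertex:
    "contractible_graph G" if "graph G" "verts G = {v}"
| remove_vertex:
    "contractible_graph G" if "graph G" "v \<in> verts G"
      "contractible_graph (unit_sphere G v)" "contractible_graph (G \<restriction> (verts G - {v}))"

inductive evako_graph :: "int \<Rightarrow> ('a, 'b) pre_digraph \<Rightarrow> bool"
  and evako_sphere :: "int \<Rightarrow> ('a, 'b) pre_digraph \<Rightarrow> bool" where
  evako_graph:
    "evako_graph k G" if "0 \<le> k" "graph G"
      "\<And>x. x \<in> verts G \<Longrightarrow> evako_sphere (k - 1) (unit_sphere G x)"
| empty_sphere:
    "evako_sphere (- 1) G" if "graph G" "verts G = {}"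
| evako_sphere:
    "evako_sphere k G" if "evako_graph k G" "x \<in> verts G"
      "contractible_graph (G \<restriction> (verts G - {x}))"

definition morse_function :: "('a, 'b) pre_digraph \<Rightarrow> ('a \<Rightarrow> real) \<Rightarrow> bool" where
  "morse_function G f \<longleftrightarrow>
     (\<forall>x y. x \<rightarrow>\<^bsub>G\<^esub> y \<longrightarrow> f x \<noteq> f y) \<and>
     (\<forall>x \<in> verts G. \<exists>m \<ge> - 1. evako_sphere m (lower_sphere G f x))"

text \<open>The dimension of a sphere is unique, so the description in \<open>morse_index\<close> is proper.\<close>

lemma evako_sphere_cases:
  assumes "evako_sphere k G"
  shows "k = - 1 \<and> verts G = {} \<or>
    0 \<le> k \<and> verts G \<noteq> {} \<and> (\<forall>x \<in> verts G. evako_sphere (k - 1) (unit_sphere G x))"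
  using assms by (cases rule: evako_sphere.cases) (auto elim: evako_graph.cases)

lemma evako_sphere_dim_unique:
  assumes "evako_sphere k G" "evako_sphere l G"
  shows "k = l"
proof -
  have "\<forall>(G :: ('a, 'b) pre_digraph) k l.
      nat (k + 1) = n \<longrightarrow> evako_sphere k G \<longrightarrow> evako_sphere l G \<longrightarrow> k = l" for n
  proof (induction n)
    case 0
    show ?case
    proof (intro allI impI)
      fix G :: "('a, 'b) pre_digraph" and k l :: int
      assume "nat (k + 1) = 0" "evako_sphere k G" "evako_sphere l G"
      then show "k = l"
        using evako_sphere_cases[of k G] evako_sphere_cases[of l G] by linarith
    qed
  next
    case (Suc n)
    show ?case
    proof (intro allI impI)
      fix G :: "('a, 'b) pre_digraph" and k l :: int
      assume n: "nat (k + 1) = Suc n" and k: "evako_sphere k G" and l: "evako_sphere l G"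
      from n evako_sphere_cases[OF k] obtain x
        where x: "x \<in> verts G" "evako_sphere (k - 1) (unit_sphere G x)" by auto
      with evako_sphere_cases[OF l] have "evako_sphere (l - 1) (unit_sphere G x)" by auto
      moreover from n have "nat (k - 1 + 1) = n" by simp
      ultimately show "k = l" using Suc.IH x(2) by fastforce
    qed
  qed
  with assms show ?thesis by blast
qed

definition morse_index :: "('a, 'b) pre_digraph \<Rightarrow> ('a \<Rightarrow> real) \<Rightarrow> 'a \<Rightarrow> int" where
  "morse_index G f x = (THE m. evako_sphere m (lower_sphere G f x)) + 1"

text \<open>Every vertex is a critical point of a Morse function.\<close>

definition critical_count :: "('a, 'b) pre_digraph \<Rightarrow> ('a \<Rightarrow> real) \<Rightarrow> nat \<Rightarrow> nat" where
  "critical_count G f k = card {x \<in> verts G. morse_index G f x = int k}"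


section \<open>Real simplicial cohomology of the Whitney complex\<close>

definition whitney_complex :: "('a, 'b) pre_digraph \<Rightarrow> 'a set set" where
  "whitney_complex G =
     {s. s \<noteq> {} \<and> s \<subseteq> verts G \<and> (\<forall>u \<in> s. \<forall>v \<in> s. u \<noteq> v \<longrightarrow> u \<rightarrow>\<^bsub>G\<^esub> v)}"

text \<open>
  A \<open>k\<close>-cochain of a simplicial complex \<open>K\<close> is an alternating real function on the \<open>k\<close>-simplices with
  ordered vertices, extended by zero to all other lists so that equality of cochains is equality
  of functions.
\<close>

definition ordered_simplices :: "'a set set \<Rightarrow> nat \<Rightarrow> 'a list set" where
  "ordered_simplices K k = {xs. distinct xs \<and> length xs = Suc k \<and> set xs \<in> K}"

definition cochains :: "'a set set \<Rightarrow> nat \<Rightarrow> ('a list \<Rightarrow> real) set" where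
  "cochains K k =
     {\<phi>. (\<forall>xs. xs \<notin> ordered_simplices K k \<longrightarrow> \<phi> xs = 0) \<and>
          (\<forall>xs \<in> ordered_simplices K k. \<forall>p. p permutes {..<Suc k} \<longrightarrow>
             \<phi> (permute_list p xs) = of_int (sign p) * \<phi> xs)}"

definition coboundary :: "'a set set \<Rightarrow> nat \<Rightarrow> ('a list \<Rightarrow> real) \<Rightarrow> 'a list \<Rightarrow> real" where
  "coboundary K k \<phi> xs =
     (if xs \<in> ordered_simplices K (Suc k)
      then \<Sum>i\<le>Suc k. (- 1) ^ i * \<phi> (take i xs @ drop (Suc i) xs)
      else 0)"

definition cocycles :: "'a set set \<Rightarrow> nat \<Rightarrow> ('a list \<Rightarrow> real) set" where
  "cocycles K k = {\<phi> \<in> cochains K k. coboundary K k \<phi> = (\<lambda>_. 0)}"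

definition coboundaries :: "'a set set \<Rightarrow> nat \<Rightarrow> ('a list \<Rightarrow> real) set" where
  "coboundaries K k = (case k of 0 \<Rightarrow> {\<lambda>_. 0} | Suc j \<Rightarrow> coboundary K j ` cochains K j)"

text \<open>
  Modules are records extending rings; the ring multiplication and unit of the record play no role
  in a module and are left undefined.
\<close>

definition cocycle_space :: "'a set set \<Rightarrow> nat \<Rightarrow> (real, 'a list \<Rightarrow> real) module" where
  "cocycle_space K k =
     \<lparr>carrier = cocycles K k, mult = undefined, one = undefined,
      zero = (\<lambda>_. 0), add = (\<lambda>\<phi> \<psi> xs. \<phi> xs + \<psi> xs), smult = (\<lambda>c \<phi> xs. c * \<phi> xs)\<rparr>"

definition quotient_module :: "('r, 'v) module \<Rightarrow> 'v set \<Rightarrow> ('r, 'v set) module" where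
  "quotient_module M N =
     \<lparr>carrier = a_rcosets\<^bsub>M\<^esub> N, mult = undefined, one = undefined,
      zero = N, add = set_add M, smult = (\<lambda>c A. \<Union>a\<in>A. N +>\<^bsub>M\<^esub> (c \<odot>\<^bsub>M\<^esub> a))\<rparr>"

definition cohomology :: "'a set set \<Rightarrow> nat \<Rightarrow> (real, ('a list \<Rightarrow> real) set) module" where
  "cohomology K k = quotient_module (cocycle_space K k) (coboundaries K k)"

definition betti_number :: "('a, 'b) pre_digraph \<Rightarrow> nat \<Rightarrow> nat" where
  "betti_number G k = vectorspace.dim class_ring (cohomology (whitney_complex G) k)"

end

theory Submission
  imports Defs "HOL-Library.Function_Algebras"
begin

text \<open>
  Order the vertices by the value of \<open>f\<close> and add them one at a time. Adding \<open>x\<close> attaches to the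
  Whitney complex built so far a cone with apex \<open>x\<close> over the Whitney complex of \<open>S\<^sup>-\<^sub>f(x)\<close>, because
  local injectivity makes \<open>S\<^sup>-\<^sub>f(x)\<close> consist of exactly the neighbours of \<open>x\<close> already present. In the
  long exact sequence of the pair, the relative cohomology is the reduced cohomology of \<open>S\<^sup>-\<^sub>f(x)\<close>
  shifted up by one degree. If \<open>S\<^sup>-\<^sub>f(x)\<close> is an \<open>m\<close>-sphere, this is at most one-dimensional and
  vanishes outside degree \<open>m + 1\<close>, the Morse index of \<open>x\<close>. Hence adding \<open>x\<close> raises \<open>b\<^sub>k\<close> by at most
  one, and only if the index is \<open>k\<close>; summing over all vertices gives \<open>b\<^sub>k \<le> c\<^sub>k\<close>.

  The same step computes what is needed about spheres. Writing \<open>H\<close> for reduced cohomology, exactness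
  gives for every vertex \<open>v\<close> of a graph
  \<open>dim H\<^sup>k(G) \<le> dim H\<^sup>k(G - v) + dim H\<^sup>k\<^sup>-\<^sup>1(S(v))\<close>. By induction over
  the definition of contractibility the reduced cohomology of a contractible graph vanishes; removing
  from an \<open>m\<close>-sphere a vertex with contractible complement, whose unit sphere is an \<open>(m - 1)\<close>-sphere,
  then bounds the cohomology of the \<open>m\<close>-sphere.

  All three uses are instances of one lemma, \<open>betti_le_remove_vertex\<close>, about a family \<open>K\<close> of vertex
  sets closed under nonempty subsets. Such a family may or may not contain the empty simplex, and this
  single bit decides whether its cochain complex is the augmented one (reduced cohomology) or the
  ordinary one. The link of a vertex always contains the empty simplex, so reduced cohomology of
  \<open>S\<^sup>-\<^sub>f(x)\<close> appears by itself. Only upper bounds occur, so the dimension of a quotient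
  \<open>Z / B\<close> is handled throughout as the number of elements that span \<open>Z\<close> together with \<open>B\<close>.
\<close>

section \<open>Relative dimension of spaces of functions\<close>

text \<open>
  A linear map \<open>T\<close> injects \<open>Z / T\<^sup>-\<^sup>1(W)\<close> into the quotient of the target by \<open>W\<close>, so spanning
  sets of the latter bound the dimension of the former. Elements of \<open>A\<close> may lie outside the image of
  \<open>T\<close>, so the induction exchanges each of them for an element of \<open>Z\<close> whose image involves it, and
  drops it if there is none.
\<close>

lemma (in vector_space_pair) spanned_mod_preimage:
  assumes lin: "Vector_Spaces.linear s1 s2 T" and "finite A"
    and "vs1.subspace Z" and "T ` Z \<subseteq> vs2.span (A \<union> W)"
  shows "\<exists>A'. A' \<subseteq> Z \<and> finite A' \<and> card A' \<le> card A \<and>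
    Z \<subseteq> vs1.span (A' \<union> {z \<in> Z. T z \<in> vs2.span W})"
  using assms(2-4)
proof (induction A arbitrary: Z rule: finite_induct)
  case empty
  then have "Z \<subseteq> {z \<in> Z. T z \<in> vs2.span W}" by auto
  then have "Z \<subseteq> vs1.span ({} \<union> {z \<in> Z. T z \<in> vs2.span W})"
    using vs1.span_superset by fastforce
  then show ?case by (intro exI[of _ "{}"]) simp
next
  case (insert a A)
  interpret T: Vector_Spaces.linear s1 s2 T by (rule lin)
  show ?case
  proof (cases "T ` Z \<subseteq> vs2.span (A \<union> W)")
    case True
    from insert.IH[OF insert.prems(1) this] insert.hyps show ?thesis
      by (auto intro: le_SucI)
  next
    case False
    then obtain z0 where z0: "z0 \<in> Z" "T z0 \<notin> vs2.span (A \<union> W)" by auto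
    have img: "\<exists>k. T z - s2 k a \<in> vs2.span (A \<union> W)" if "z \<in> Z" for z
      using insert.prems(2) that vs2.span_breakdown_eq[of "T z" a "A \<union> W"] by auto
    from img[OF z0(1)] obtain k where k: "T z0 - s2 k a \<in> vs2.span (A \<union> W)" by blast
    with z0(2) have "k \<noteq> 0" by auto
    define Z0 where "Z0 = {z \<in> Z. T z \<in> vs2.span (A \<union> W)}"
    have "Z0 = Z \<inter> {z. T z \<in> vs2.span (A \<union> W)}" unfolding Z0_def by auto
    then have "vs1.subspace Z0"
      using insert.prems(1) T.subspace_linear_preimage[OF vs2.subspace_span]
      by (simp add: vs1.subspace_inter)
    moreover have "T ` Z0 \<subseteq> vs2.span (A \<union> W)" unfolding Z0_def by auto
    ultimately have "\<exists>A'. A' \<subseteq> Z0 \<and> finite A' \<and> card A' \<le> card A \<and>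
        Z0 \<subseteq> vs1.span (A' \<union> {z \<in> Z0. T z \<in> vs2.span W})"
      by (rule insert.IH)
    then obtain A' where A': "A' \<subseteq> Z0" "finite A'" "card A' \<le> card A"
      "Z0 \<subseteq> vs1.span (A' \<union> {z \<in> Z0. T z \<in> vs2.span W})"
      by (elim exE conjE)
    \<comment> \<open>\<open>z0\<close> has a nonzero coefficient \<open>k\<close> at \<open>a\<close>, so it clears the \<open>a\<close>-part of every other element.\<close>
    let ?S = "vs1.span (insert z0 A' \<union> {z \<in> Z. T z \<in> vs2.span W})"
    have sub: "Z0 \<subseteq> ?S"
    proof (rule order_trans[OF A'(4)], rule vs1.span_mono)
      show "A' \<union> {z \<in> Z0. T z \<in> vs2.span W} \<subseteq> insert z0 A' \<union> {z \<in> Z. T z \<in> vs2.span W}"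
        unfolding Z0_def by auto
    qed
    have "Z \<subseteq> ?S"
    proof
      fix z assume z: "z \<in> Z"
      from img[OF this] obtain l where l: "T z - s2 l a \<in> vs2.span (A \<union> W)" by blast
      let ?w = "z - s1 (l / k) z0"
      have "T ?w = (T z - s2 l a) - s2 (l / k) (T z0 - s2 k a)"
        using \<open>k \<noteq> 0\<close> by (simp add: T.diff T.scale vs2.scale_right_diff_distrib)
      also have "\<dots> \<in> vs2.span (A \<union> W)" by (rule vs2.span_diff[OF l vs2.span_scale[OF k]])
      finally have "?w \<in> Z0" unfolding Z0_def
        using z z0(1) insert.prems(1) by (simp add: vs1.subspace_diff vs1.subspace_scale)
      then have "?w \<in> ?S" using sub by auto
      moreover have "s1 (l / k) z0 \<in> ?S" by (intro vs1.span_scale vs1.span_base) simp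
      ultimately have "?w + s1 (l / k) z0 \<in> ?S" by (rule vs1.span_add)
      then show "z \<in> ?S" by simp
    qed
    moreover have "insert z0 A' \<subseteq> Z" using A'(1) z0(1) unfolding Z0_def by auto
    moreover have "card (insert z0 A') \<le> card (insert a A)"
      using A'(2,3) insert.hyps by (simp add: card_insert_if)
    ultimately show ?thesis using A'(2) by (intro exI[of _ "insert z0 A'"]) simp
  qed
qed

definition scale_fun :: "real \<Rightarrow> ('a \<Rightarrow> real) \<Rightarrow> 'a \<Rightarrow> real" where
  "scale_fun c f = (\<lambda>x. c * f x)"

lemma scale_fun_apply [simp]: "scale_fun c f x = c * f x"
  by (simp add: scale_fun_def)

interpretation fun_space: vector_space scale_fun
  by unfold_locales (simp_all add: fun_eq_iff algebra_simps)

interpretation fun_spaces: vector_space_pair scale_fun scale_fun ..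

text \<open>
  For subspaces \<open>B \<subseteq> Z\<close> this says \<open>dim (Z / B) \<le> r\<close>.
\<close>

definition codim_le :: "('a \<Rightarrow> real) set \<Rightarrow> ('a \<Rightarrow> real) set \<Rightarrow> nat \<Rightarrow> bool" where
  "codim_le Z B r \<longleftrightarrow> (\<exists>A \<subseteq> Z. finite A \<and> card A \<le> r \<and> Z \<subseteq> fun_space.span (A \<union> B))"

lemma codim_le_span:
  assumes "Z \<subseteq> fun_space.span B"
  shows "codim_le Z B r"
  unfolding codim_le_def using assms by (intro exI[of _ "{}"]) simp

lemma codim_le_mono:
  assumes "codim_le Z B r" "B \<subseteq> B'"
  shows "codim_le Z B' r"
proof -
  have "fun_space.span (A \<union> B) \<subseteq> fun_space.span (A \<union> B')" for A
    using assms(2) by (intro fun_space.span_mono) blast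
  with assms(1) show ?thesis unfolding codim_le_def by blast
qed

text \<open>
  Dimensions of successive quotients add up. The generators that \<open>W\<close> contributes come from \<open>W'\<close>, a
  space of chosen representatives for the elements of \<open>W\<close> modulo \<open>B\<close>.
\<close>

lemma codim_le_trans:
  assumes "codim_le Z W r" "codim_le W' B s" "W \<subseteq> fun_space.span (W' \<union> B)" "W' \<subseteq> Z"
  shows "codim_le Z B (r + s)"
proof -
  from assms obtain A A' where A: "A \<subseteq> Z" "finite A" "card A \<le> r" "Z \<subseteq> fun_space.span (A \<union> W)"
    and A': "A' \<subseteq> W'" "finite A'" "card A' \<le> s" "W' \<subseteq> fun_space.span (A' \<union> B)"
    unfolding codim_le_def by blast
  let ?S = "fun_space.span (A \<union> A' \<union> B)"
  have 1: "X \<subseteq> ?S" if "X \<subseteq> A \<union> A' \<union> B" for X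
    using that fun_space.span_superset by blast
  have "W' \<subseteq> ?S"
    using A'(4) fun_space.span_mono[of "A' \<union> B" "A \<union> A' \<union> B"] by blast
  then have "fun_space.span (W' \<union> B) \<subseteq> ?S" using 1[of B] by (intro fun_space.span_minimal) auto
  then have "fun_space.span (A \<union> W) \<subseteq> ?S"
    using 1[of A] assms(3) by (intro fun_space.span_minimal) auto
  then have "Z \<subseteq> ?S" using A(4) by blast
  moreover have "card (A \<union> A') \<le> r + s" using card_Un_le[of A A'] A(3) A'(3) by linarith
  ultimately show ?thesis unfolding codim_le_def using A A' assms(4)
    by (intro exI[of _ "A \<union> A'"]) auto
qed

lemma codim_le_preimage:
  assumes "Vector_Spaces.linear scale_fun scale_fun T" "fun_space.subspace Z"
    and "fun_space.subspace B'" "T ` Z \<subseteq> Z'" "codim_le Z' B' r"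
  shows "codim_le Z {z \<in> Z. T z \<in> B'} r"
proof -
  from assms(5) obtain A where A: "finite A" "card A \<le> r" "Z' \<subseteq> fun_space.span (A \<union> B')"
    unfolding codim_le_def by blast
  then have "T ` Z \<subseteq> fun_space.span (A \<union> B')" using assms(4) by blast
  from fun_spaces.spanned_mod_preimage[OF assms(1) A(1) assms(2) this]
  show ?thesis using A(2) assms(3)
    unfolding codim_le_def fun_space.span_eq_iff[THEN iffD2, OF assms(3)]
    by (meson order_trans)
qed


section \<open>Alternating cochains\<close>

text \<open>
  Adjacent swaps generate all permutations, and unlike general permutations they commute well with
  recursion over lists; \<open>alternating_antisymmetric\<close> below recovers the sign rule for all permutations.
\<close>

definition alternating :: "('a list \<Rightarrow> real) \<Rightarrow> bool" where
  "alternating \<phi> \<longleftrightarrow> (\<forall>us x y ws. \<phi> (us @ x # y # ws) = - \<phi> (us @ y # x # ws))"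

lemma alternatingD: "alternating \<phi> \<Longrightarrow> \<phi> (us @ x # y # ws) = - \<phi> (us @ y # x # ws)"
  unfolding alternating_def by blast

lemma alternating_Cons: "alternating \<phi> \<Longrightarrow> alternating (\<lambda>ys. \<phi> (u # ys))"
  unfolding alternating_def by (metis append_Cons)

text \<open>
  Cochains are graded by the number \<open>n\<close> of vertices, so that the empty simplex has degree \<open>0\<close> and
  degree \<open>n\<close> corresponds to simplices of dimension \<open>n - 1\<close>.
\<close>

definition alt_cochains :: "'a set set \<Rightarrow> nat \<Rightarrow> ('a list \<Rightarrow> real) set" where
  "alt_cochains K n =
     {\<phi>. alternating \<phi> \<and> (\<forall>xs. \<phi> xs \<noteq> 0 \<longrightarrow> distinct xs \<and> length xs = n \<and> set xs \<in> K)}"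

text \<open>
  The alternating sum of \<open>\<phi>\<close> over the lists with one entry removed, in a recursive form: either the
  head is removed, or an entry of the tail, which costs a sign.
\<close>

fun face_sum :: "('a list \<Rightarrow> real) \<Rightarrow> 'a list \<Rightarrow> real" where
  "face_sum \<phi> [] = 0"
| "face_sum \<phi> (x # xs) = \<phi> xs - face_sum (\<lambda>ys. \<phi> (x # ys)) xs"

lemma face_sum_cong:
  assumes "\<And>us x ws. xs = us @ x # ws \<Longrightarrow> \<phi> (us @ ws) = \<psi> (us @ ws)"
  shows "face_sum \<phi> xs = face_sum \<psi> xs"
  using assms
proof (induction xs arbitrary: \<phi> \<psi>)
  case (Cons x xs)
  have "\<phi> xs = \<psi> xs" using Cons.prems[of "[]" x xs] by simp
  moreover have "face_sum (\<lambda>ys. \<phi> (x # ys)) xs = face_sum (\<lambda>ys. \<psi> (x # ys)) xs"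
    by (rule Cons.IH) (use Cons.prems[of "x # _"] in simp)
  ultimately show ?case by simp
qed simp

lemma face_sum_zero [simp]: "face_sum (\<lambda>_. 0) xs = 0"
  by (induction xs) simp_all

lemma face_sum_add: "face_sum (\<lambda>ys. \<phi> ys + \<psi> ys) xs = face_sum \<phi> xs + face_sum \<psi> xs"
  by (induction xs arbitrary: \<phi> \<psi>) simp_all

lemma face_sum_scale: "face_sum (\<lambda>ys. c * \<phi> ys) xs = c * face_sum \<phi> xs"
  by (induction xs arbitrary: \<phi>) (simp_all add: algebra_simps)

lemma face_sum_diff: "face_sum (\<lambda>ys. \<phi> ys - \<psi> ys) xs = face_sum \<phi> xs - face_sum \<psi> xs"
  by (induction xs arbitrary: \<phi> \<psi>) simp_all

lemma face_sum_minus: "face_sum (\<lambda>ys. - \<phi> ys) xs = - face_sum \<phi> xs"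
  by (induction xs arbitrary: \<phi>) simp_all

text \<open>
  In the induction the two terms \<open>face_sum \<phi> xs\<close>, from removing the head first or last, cancel.
\<close>

lemma face_sum_face_sum: "face_sum (face_sum \<phi>) xs = 0"
  by (induction xs arbitrary: \<phi>) (simp_all add: face_sum_diff)

lemma face_sum_swap:
  assumes "alternating \<phi>"
  shows "face_sum \<phi> (us @ x # y # ws) = - face_sum \<phi> (us @ y # x # ws)"
  using assms
proof (induction us arbitrary: \<phi>)
  case Nil
  have "\<phi> (x # y # zs) = - \<phi> (y # x # zs)" for zs
    using alternatingD[OF Nil, of "[]" x y zs] by simp
  then have "(\<lambda>zs. \<phi> (x # y # zs)) = (\<lambda>zs. - \<phi> (y # x # zs))" by (rule ext)
  then show ?case by (simp add: face_sum_minus)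
next
  case (Cons u us)
  show ?case
    using Cons.IH[OF alternating_Cons[OF Cons.prems, of u]] alternatingD[OF Cons.prems, of us x y ws]
    by simp
qed

lemma face_sum_conv_sum:
  "face_sum \<phi> xs = (\<Sum>i<length xs. (- 1) ^ i * \<phi> (take i xs @ drop (Suc i) xs))"
proof (induction xs arbitrary: \<phi>)
  case (Cons x xs)
  have "(\<Sum>i<length (x # xs). (- 1) ^ i * \<phi> (take i (x # xs) @ drop (Suc i) (x # xs))) =
      \<phi> xs + (\<Sum>i<length xs. - ((- 1) ^ i * \<phi> (x # take i xs @ drop (Suc i) xs)))"
    unfolding list.size(4) add_Suc_right add_0_right sum.lessThan_Suc_shift by simp
  then show ?case by (simp only: face_sum.simps Cons.IH sum_negf)
qed simp

definition alt_coboundary :: "'a set set \<Rightarrow> ('a list \<Rightarrow> real) \<Rightarrow> 'a list \<Rightarrow> real" where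
  "alt_coboundary K \<phi> xs = (if distinct xs \<and> set xs \<in> K then face_sum \<phi> xs else 0)"

definition alt_cocycles :: "'a set set \<Rightarrow> nat \<Rightarrow> ('a list \<Rightarrow> real) set" where
  "alt_cocycles K n = {\<phi> \<in> alt_cochains K n. alt_coboundary K \<phi> = 0}"

definition alt_coboundaries :: "'a set set \<Rightarrow> nat \<Rightarrow> ('a list \<Rightarrow> real) set" where
  "alt_coboundaries K n =
     (case n of 0 \<Rightarrow> {0} | Suc m \<Rightarrow> alt_coboundary K ` alt_cochains K m)"

text \<open>
  The empty set is left free: with it the complex \<open>K\<close> is augmented, without it \<open>K\<close> is not.
\<close>

definition simplicial :: "'a set set \<Rightarrow> bool" where
  "simplicial K \<longleftrightarrow> (\<forall>s \<in> K. \<forall>t \<subseteq> s. t \<noteq> {} \<longrightarrow> t \<in> K)"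

lemma alt_cochains_alternating: "\<phi> \<in> alt_cochains K n \<Longrightarrow> alternating \<phi>"
  unfolding alt_cochains_def by blast

lemma alt_cochains_support:
  "\<phi> \<in> alt_cochains K n \<Longrightarrow> \<not> (distinct xs \<and> length xs = n \<and> set xs \<in> K) \<Longrightarrow> \<phi> xs = 0"
  unfolding alt_cochains_def by blast

lemma alternating_add: "alternating \<phi> \<Longrightarrow> alternating \<psi> \<Longrightarrow> alternating (\<phi> + \<psi>)"
  unfolding alternating_def[of "\<phi> + \<psi>"]
  by (metis alternatingD minus_add_distrib plus_fun_apply)

lemma alternating_scale: "alternating \<phi> \<Longrightarrow> alternating (scale_fun c \<phi>)"
  unfolding alternating_def[of "scale_fun c \<phi>"]
  by (metis alternatingD mult_minus_right scale_fun_apply)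

lemma subspace_alt_cochains: "fun_space.subspace (alt_cochains K n)"
proof (rule fun_space.subspaceI)
  show "0 \<in> alt_cochains K n" by (simp add: alt_cochains_def alternating_def)
next
  fix \<phi> \<psi> assume "\<phi> \<in> alt_cochains K n" "\<psi> \<in> alt_cochains K n"
  moreover have "\<phi> xs \<noteq> 0 \<or> \<psi> xs \<noteq> 0" if "(\<phi> + \<psi>) xs \<noteq> 0" for xs using that by auto
  ultimately show "\<phi> + \<psi> \<in> alt_cochains K n"
    using alternating_add unfolding alt_cochains_def mem_Collect_eq by blast
next
  fix c \<phi> assume "\<phi> \<in> alt_cochains K n"
  moreover have "\<phi> xs \<noteq> 0" if "scale_fun c \<phi> xs \<noteq> 0" for xs using that by auto
  ultimately show "scale_fun c \<phi> \<in> alt_cochains K n"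
    using alternating_scale unfolding alt_cochains_def mem_Collect_eq by blast
qed

lemma linear_fun_spaceI:
  assumes "\<And>\<phi> \<psi>. T (\<phi> + \<psi>) = T \<phi> + T \<psi>" "\<And>c \<phi>. T (scale_fun c \<phi>) = scale_fun c (T \<phi>)"
  shows "Vector_Spaces.linear scale_fun scale_fun T"
  unfolding Vector_Spaces.linear_iff by (simp add: assms fun_space.vector_space_axioms)

lemma alt_coboundary_add: "alt_coboundary K (\<phi> + \<psi>) = alt_coboundary K \<phi> + alt_coboundary K \<psi>"
  by (rule ext) (simp add: alt_coboundary_def plus_fun_def face_sum_add)

lemma alt_coboundary_scale: "alt_coboundary K (scale_fun c \<phi>) = scale_fun c (alt_coboundary K \<phi>)"
  by (rule ext) (simp add: alt_coboundary_def scale_fun_def face_sum_scale)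

lemma alt_coboundary_minus: "alt_coboundary K (- \<phi>) = - alt_coboundary K \<phi>"
  by (rule ext) (simp add: alt_coboundary_def fun_Compl_def face_sum_minus)

lemma alt_coboundary_diff: "alt_coboundary K (\<phi> - \<psi>) = alt_coboundary K \<phi> - alt_coboundary K \<psi>"
  by (rule ext) (simp add: alt_coboundary_def fun_diff_def face_sum_diff)

lemma linear_alt_coboundary: "Vector_Spaces.linear scale_fun scale_fun (alt_coboundary K)"
  by (rule linear_fun_spaceI) (rule alt_coboundary_add alt_coboundary_scale)+

text \<open>
  The coboundary of an alternating cochain is again alternating: swapping \<open>x\<close> and \<open>y\<close> exchanges the
  two terms that omit one of them, and these carry opposite signs.
\<close>

lemma alt_coboundary_in_cochains:
  fixes \<phi> :: "'a list \<Rightarrow> real"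
  assumes "\<phi> \<in> alt_cochains K n"
  shows "alt_coboundary K \<phi> \<in> alt_cochains K (Suc n)"
proof -
  have "length xs = Suc n" if "face_sum \<phi> xs \<noteq> 0" for xs
  proof (rule ccontr)
    assume "length xs \<noteq> Suc n"
    have "face_sum \<phi> xs = face_sum (\<lambda>_. 0) xs"
    proof (rule face_sum_cong)
      fix us x ws assume "xs = us @ x # ws"
      with \<open>length xs \<noteq> Suc n\<close> have "length (us @ ws) \<noteq> n" by auto
      then show "\<phi> (us @ ws) = 0" using alt_cochains_support[OF assms] by blast
    qed
    with that show False by simp
  qed
  moreover have "alternating (alt_coboundary K \<phi>)"
    unfolding alternating_def
  proof (intro allI)
    fix us ws :: "'a list" and x y :: 'a
    have "distinct (us @ x # y # ws) = distinct (us @ y # x # ws)" by auto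
    moreover have "set (us @ x # y # ws) = set (us @ y # x # ws)" by auto
    moreover have "face_sum \<phi> (us @ x # y # ws) = - face_sum \<phi> (us @ y # x # ws)"
      by (rule face_sum_swap[OF alt_cochains_alternating[OF assms]])
    ultimately show "alt_coboundary K \<phi> (us @ x # y # ws) = - alt_coboundary K \<phi> (us @ y # x # ws)"
      unfolding alt_coboundary_def
      by (cases "distinct (us @ y # x # ws) \<and> set (us @ y # x # ws) \<in> K")
        (simp_all only: if_True if_False minus_zero simp_thms)
  qed
  ultimately show ?thesis unfolding alt_cochains_def alt_coboundary_def by auto
qed

lemma alt_coboundary_alt_coboundary:
  assumes "simplicial K"
  shows "alt_coboundary K (alt_coboundary K \<phi>) = 0"
proof
  fix xs
  show "alt_coboundary K (alt_coboundary K \<phi>) xs = 0 xs"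
  proof (cases "distinct xs \<and> set xs \<in> K")
    case True
    have "face_sum (alt_coboundary K \<phi>) xs = face_sum (face_sum \<phi>) xs"
    proof (rule face_sum_cong)
      fix us x ws assume xs: "xs = us @ x # ws"
      show "alt_coboundary K \<phi> (us @ ws) = face_sum \<phi> (us @ ws)"
        \<comment> \<open>If \<open>us @ ws\<close> is empty then both sides vanish, whether or not \<open>K\<close> contains the empty simplex.\<close>
      proof (cases "us @ ws = []")
        case False
        have "set (us @ ws) \<subseteq> set xs" using xs by auto
        moreover have "set (us @ ws) \<noteq> {}" using False by auto
        ultimately have "set (us @ ws) \<in> K" using assms True unfolding simplicial_def by blast
        moreover have "distinct (us @ ws)" using True xs by auto
        ultimately show ?thesis unfolding alt_coboundary_def by simp
      qed (simp add: alt_coboundary_def)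
    qed
    then show ?thesis unfolding alt_coboundary_def[of K "alt_coboundary K \<phi>"]
      by (simp add: face_sum_face_sum)
  next
    case False
    then show ?thesis unfolding alt_coboundary_def[of K "alt_coboundary K \<phi>"] by auto
  qed
qed

lemma subspace_alt_cocycles: "fun_space.subspace (alt_cocycles K n)"
proof -
  have "alt_coboundary K 0 = 0"
    using alt_coboundary_diff[of K "0 :: _ \<Rightarrow> real" 0] by simp
  then show ?thesis
    using subspace_alt_cochains[of K n]
    unfolding fun_space.subspace_def alt_cocycles_def
    by (simp add: alt_coboundary_add alt_coboundary_scale)
qed

lemma subspace_alt_coboundaries: "fun_space.subspace (alt_coboundaries K n)"
proof (cases n)
  case (Suc m)
  interpret D: Vector_Spaces.linear scale_fun scale_fun "alt_coboundary K"
    by (rule linear_alt_coboundary)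
  show ?thesis using D.subspace_image[OF subspace_alt_cochains[of K m]] Suc
    by (simp add: alt_coboundaries_def)
qed (simp add: alt_coboundaries_def)

lemma alt_coboundaries_subset_cocycles:
  assumes "simplicial K"
  shows "alt_coboundaries K n \<subseteq> alt_cocycles K n"
proof (cases n)
  case 0
  then show ?thesis using fun_space.subspace_0[OF subspace_alt_cocycles[of K n]]
    by (simp add: alt_coboundaries_def)
next
  case (Suc m)
  then show ?thesis
    unfolding alt_coboundaries_def alt_cocycles_def
    using alt_coboundary_in_cochains alt_coboundary_alt_coboundary[OF assms] by auto
qed

text \<open>
  A bound on the dimension of the cohomology carried by the simplices with \<open>n\<close> vertices, that is of
  \<open>H\<^sup>n\<^sup>-\<^sup>1\<close> in the usual grading.
\<close>

definition betti_le :: "'a set set \<Rightarrow> nat \<Rightarrow> nat \<Rightarrow> bool" where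
  "betti_le K n r \<longleftrightarrow> codim_le (alt_cocycles K n) (alt_coboundaries K n) r"


section \<open>Removing a vertex\<close>

definition deletion :: "'a set set \<Rightarrow> 'a \<Rightarrow> 'a set set" where
  "deletion K v = {s \<in> K. v \<notin> s}"

definition link :: "'a set set \<Rightarrow> 'a \<Rightarrow> 'a set set" where
  "link K v = {s. v \<notin> s \<and> insert v s \<in> K}"

definition restrict_cochain :: "'a \<Rightarrow> ('a list \<Rightarrow> real) \<Rightarrow> 'a list \<Rightarrow> real" where
  "restrict_cochain v \<phi> xs = (if v \<in> set xs then 0 else \<phi> xs)"

text \<open>
  Together with its inverse \<open>cone_cochain\<close>, this identifies the cochains of \<open>K\<close> that vanish on
  \<open>deletion K v\<close> with the cochains of \<open>link K v\<close>, one degree lower.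
\<close>

definition contract_cochain :: "'a \<Rightarrow> ('a list \<Rightarrow> real) \<Rightarrow> 'a list \<Rightarrow> real" where
  "contract_cochain v \<phi> xs = \<phi> (v # xs)"

text \<open>
  The value of \<open>\<chi>\<close> on the list without \<open>v\<close>, with the sign for moving \<open>v\<close> to the front.
\<close>

fun cone_cochain :: "'a \<Rightarrow> ('a list \<Rightarrow> real) \<Rightarrow> 'a list \<Rightarrow> real" where
  "cone_cochain v \<chi> [] = 0"
| "cone_cochain v \<chi> (x # xs) =
     (if x = v then \<chi> xs else - cone_cochain v (\<lambda>ys. \<chi> (x # ys)) xs)"

lemma linear_restrict_cochain: "Vector_Spaces.linear scale_fun scale_fun (restrict_cochain v)"
  by (rule linear_fun_spaceI; rule ext; simp add: restrict_cochain_def)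

lemma linear_contract_cochain: "Vector_Spaces.linear scale_fun scale_fun (contract_cochain v)"
  by (rule linear_fun_spaceI; rule ext; simp add: contract_cochain_def)

lemma restrict_cochain_in_cochains:
  assumes "\<phi> \<in> alt_cochains K n"
  shows "restrict_cochain v \<phi> \<in> alt_cochains (deletion K v) n"
proof -
  have "restrict_cochain v \<phi> (us @ x # y # ws) = - restrict_cochain v \<phi> (us @ y # x # ws)" for us x y ws
    using alternatingD[OF alt_cochains_alternating[OF assms], of us x y ws]
    by (auto simp: restrict_cochain_def)
  then have "alternating (restrict_cochain v \<phi>)" unfolding alternating_def by blast
  then show ?thesis
    using assms unfolding alt_cochains_def restrict_cochain_def deletion_def by auto
qed

lemma alt_coboundary_deletion:
  "alt_coboundary (deletion K v) (restrict_cochain v \<phi>) = restrict_cochain v (alt_coboundary K \<phi>)"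
proof
  fix xs
  show "alt_coboundary (deletion K v) (restrict_cochain v \<phi>) xs =
    restrict_cochain v (alt_coboundary K \<phi>) xs"
  proof (cases "v \<in> set xs")
    case False
    then have "face_sum (restrict_cochain v \<phi>) xs = face_sum \<phi> xs"
      by (intro face_sum_cong) (simp add: restrict_cochain_def)
    with False show ?thesis
      by (simp add: alt_coboundary_def deletion_def restrict_cochain_def[of v "alt_coboundary K \<phi>"])
  qed (simp add: alt_coboundary_def deletion_def restrict_cochain_def)
qed

lemma contract_cochain_in_cochains:
  assumes "\<phi> \<in> alt_cochains K (Suc n)"
  shows "contract_cochain v \<phi> \<in> alt_cochains (link K v) n"
proof -
  have "alternating (contract_cochain v \<phi>)"
    unfolding contract_cochain_def by (rule alternating_Cons[OF alt_cochains_alternating[OF assms]])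
  moreover have "distinct xs \<and> length xs = n \<and> set xs \<in> link K v" if "contract_cochain v \<phi> xs \<noteq> 0" for xs
    using alt_cochains_support[OF assms, of "v # xs"] that
    unfolding contract_cochain_def link_def by auto
  ultimately show ?thesis unfolding alt_cochains_def by blast
qed

text \<open>
  Among the faces of \<open>v # xs\<close>, the face \<open>xs\<close> contributes nothing as \<open>\<phi>\<close> vanishes away from \<open>v\<close>; the
  remaining faces are those of \<open>xs\<close>, shifted by one position.
\<close>

lemma contract_alt_coboundary:
  assumes "restrict_cochain v \<phi> = 0"
  shows "contract_cochain v (alt_coboundary K \<phi>) = - alt_coboundary (link K v) (contract_cochain v \<phi>)"
proof
  fix xs
  have "\<phi> xs = 0" if "v \<notin> set xs"
    using fun_cong[OF assms, of xs] that by (simp add: restrict_cochain_def)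
  moreover have "contract_cochain v \<phi> = (\<lambda>ys. \<phi> (v # ys))"
    by (rule ext) (simp add: contract_cochain_def)
  ultimately show "contract_cochain v (alt_coboundary K \<phi>) xs =
    (- alt_coboundary (link K v) (contract_cochain v \<phi>)) xs"
    by (simp add: contract_cochain_def[of v "alt_coboundary K \<phi>"] alt_coboundary_def link_def)
qed

lemma cone_cochain_eq_0: "v \<notin> set xs \<Longrightarrow> cone_cochain v \<chi> xs = 0"
  by (induction xs arbitrary: \<chi>) auto

lemma cone_cochain_nonzero:
  "cone_cochain v \<chi> xs \<noteq> 0 \<Longrightarrow> \<exists>us ws. xs = us @ v # ws \<and> \<chi> (us @ ws) \<noteq> 0"
proof (induction xs arbitrary: \<chi>)
  case (Cons x xs)
  show ?case
  proof (cases "x = v")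
    case True
    with Cons.prems show ?thesis by (intro exI[of _ "[]"] exI[of _ xs]) simp
  next
    case False
    with Cons.prems have "cone_cochain v (\<lambda>ys. \<chi> (x # ys)) xs \<noteq> 0" by simp
    from Cons.IH[OF this] obtain us ws where "xs = us @ v # ws" "\<chi> (x # us @ ws) \<noteq> 0" by blast
    then show ?thesis by (intro exI[of _ "x # us"] exI[of _ ws]) simp
  qed
qed simp

lemma cone_cochain_minus: "cone_cochain v (\<lambda>ys. - \<chi> ys) xs = - cone_cochain v \<chi> xs"
  by (induction xs arbitrary: \<chi>) simp_all

lemma alternating_cone_cochain:
  assumes "alternating \<chi>" "\<And>xs. v \<in> set xs \<Longrightarrow> \<chi> xs = 0"
  shows "alternating (cone_cochain v \<chi>)"
proof -
  have "cone_cochain v \<chi> (us @ x # y # ws) = - cone_cochain v \<chi> (us @ y # x # ws)" for us x y ws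
    using assms
  proof (induction us arbitrary: \<chi>)
    case Nil
    have "\<chi> (x # y # zs) = - \<chi> (y # x # zs)" for zs
      using alternatingD[OF Nil(1), of "[]" x y zs] by simp
    then have "(\<lambda>zs. \<chi> (x # y # zs)) = (\<lambda>zs. - \<chi> (y # x # zs))" by (rule ext)
    then show ?case using Nil(2)[of "v # ws"] by (auto simp: cone_cochain_minus)
  next
    case (Cons u us)
    have "cone_cochain v (\<lambda>ys. \<chi> (u # ys)) (us @ x # y # ws) =
        - cone_cochain v (\<lambda>ys. \<chi> (u # ys)) (us @ y # x # ws)"
      by (rule Cons.IH[OF alternating_Cons[OF Cons.prems(1)]]) (simp add: Cons.prems(2))
    moreover have "\<chi> (us @ x # y # ws) = - \<chi> (us @ y # x # ws)"
      by (rule alternatingD[OF Cons.prems(1)])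
    ultimately show ?case by simp
  qed
  then show ?thesis unfolding alternating_def by blast
qed

lemma cone_cochain_in_cochains:
  assumes "\<chi> \<in> alt_cochains (link K v) n"
  shows "cone_cochain v \<chi> \<in> alt_cochains K (Suc n)"
proof -
  have "\<chi> xs = 0" if "v \<in> set xs" for xs
    using alt_cochains_support[OF assms, of xs] that unfolding link_def by blast
  then have "alternating (cone_cochain v \<chi>)"
    by (rule alternating_cone_cochain[OF alt_cochains_alternating[OF assms]])
  moreover have "distinct xs \<and> length xs = Suc n \<and> set xs \<in> K" if "cone_cochain v \<chi> xs \<noteq> 0" for xs
  proof -
    from cone_cochain_nonzero[OF that] obtain us ws
      where xs: "xs = us @ v # ws" and nz: "\<chi> (us @ ws) \<noteq> 0" by blast
    have "distinct (us @ ws) \<and> length (us @ ws) = n \<and> set (us @ ws) \<in> link K v"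
      using alt_cochains_support[OF assms] nz by blast
    moreover have "insert v (set (us @ ws)) = set xs" using xs by auto
    ultimately show ?thesis unfolding link_def using xs by auto
  qed
  ultimately show ?thesis unfolding alt_cochains_def by blast
qed

lemma contract_cone_cochain: "contract_cochain v (cone_cochain v \<chi>) = \<chi>"
  by (rule ext) (simp add: contract_cochain_def)

lemma restrict_cone_cochain: "restrict_cochain v (cone_cochain v \<chi>) = 0"
  by (rule ext) (simp add: restrict_cochain_def cone_cochain_eq_0)

text \<open>
  Adjacent swaps move \<open>v\<close> to the front of any list, so \<open>contract_cochain v\<close> is injective on cochains
  that vanish away from \<open>v\<close>.
\<close>

lemma cochain_eq_0:
  assumes "alternating \<phi>" "restrict_cochain v \<phi> = 0" "contract_cochain v \<phi> = 0"
  shows "\<phi> = 0"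
proof
  fix xs
  have *: "\<phi> (us @ v # ws) = 0" for us ws
  proof (induction us arbitrary: ws rule: rev_induct)
    case Nil
    then show ?case using fun_cong[OF assms(3), of ws] by (simp add: contract_cochain_def)
  next
    case (snoc u us)
    show ?case using alternatingD[OF assms(1), of us u v ws] snoc[of "u # ws"] by simp
  qed
  show "\<phi> xs = 0 xs"
  proof (cases "v \<in> set xs")
    case True
    then obtain us ws where "xs = us @ v # ws" by (meson split_list)
    with * show ?thesis by simp
  next
    case False
    then show ?thesis using fun_cong[OF assms(2), of xs] by (simp add: restrict_cochain_def)
  qed
qed

text \<open>
  If \<open>\<phi>\<close> contracts to the coboundary of \<open>\<chi>\<close> in the link, then coning \<open>\<chi>\<close> gives a primitive of \<open>\<phi>\<close> up
  to sign, since contraction anticommutes with the coboundary.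
\<close>

lemma relative_cocycle_is_coboundary:
  assumes "\<phi> \<in> alt_cocycles K (Suc m)" "restrict_cochain v \<phi> = 0"
    and "contract_cochain v \<phi> \<in> alt_coboundaries (link K v) m"
  shows "\<phi> \<in> alt_coboundaries K (Suc m)"
proof (cases m)
  case 0
  with assms(3) have "contract_cochain v \<phi> = 0" by (simp add: alt_coboundaries_def)
  moreover have "alternating \<phi>"
    using assms(1) alt_cochains_alternating[of \<phi> K "Suc m"] by (simp add: alt_cocycles_def)
  ultimately have "\<phi> = 0" using cochain_eq_0[OF _ assms(2)] by simp
  then show ?thesis using fun_space.subspace_0[OF subspace_alt_coboundaries] by simp
next
  case (Suc j)
  with assms(3) obtain \<chi> where \<chi>: "\<chi> \<in> alt_cochains (link K v) j"
    "contract_cochain v \<phi> = alt_coboundary (link K v) \<chi>" by (auto simp: alt_coboundaries_def)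
  let ?\<eta> = "cone_cochain v \<chi>"
  have \<eta>: "?\<eta> \<in> alt_cochains K m" using cone_cochain_in_cochains[OF \<chi>(1)] Suc by simp
  let ?\<omega> = "\<phi> + alt_coboundary K ?\<eta>"
  interpret R: Vector_Spaces.linear scale_fun scale_fun "restrict_cochain v"
    by (rule linear_restrict_cochain)
  interpret C: Vector_Spaces.linear scale_fun scale_fun "contract_cochain v"
    by (rule linear_contract_cochain)
  interpret D: Vector_Spaces.linear scale_fun scale_fun "alt_coboundary (deletion K v)"
    by (rule linear_alt_coboundary)
  have "?\<omega> \<in> alt_cochains K (Suc m)"
    using assms(1) alt_coboundary_in_cochains[OF \<eta>] subspace_alt_cochains
    unfolding alt_cocycles_def by (blast intro: fun_space.subspace_add)
  then have "alternating ?\<omega>" by (rule alt_cochains_alternating)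
  moreover have "restrict_cochain v ?\<omega> = 0"
    by (simp add: R.add assms(2) alt_coboundary_deletion[symmetric] restrict_cone_cochain D.zero)
  moreover have "contract_cochain v ?\<omega> = 0"
    by (simp add: C.add \<chi>(2) contract_alt_coboundary[OF restrict_cone_cochain] contract_cone_cochain)
  ultimately have "?\<omega> = 0" by (rule cochain_eq_0)
  then have "\<phi> = alt_coboundary K (- ?\<eta>)"
    by (simp add: alt_coboundary_minus eq_neg_iff_add_eq_0)
  moreover have "- ?\<eta> \<in> alt_cochains K m"
    using \<eta> subspace_alt_cochains by (blast intro: fun_space.subspace_neg)
  ultimately show ?thesis by (simp add: alt_coboundaries_def)
qed

lemma extend_deletion_cochain:
  assumes "\<psi> \<in> alt_cochains (deletion K v) n"
  shows "\<psi> \<in> alt_cochains K n" "restrict_cochain v \<psi> = \<psi>"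
proof -
  show "\<psi> \<in> alt_cochains K n" using assms unfolding alt_cochains_def deletion_def by auto
  have "\<psi> xs = 0" if "v \<in> set xs" for xs
    using alt_cochains_support[OF assms, of xs] that unfolding deletion_def by blast
  then show "restrict_cochain v \<psi> = \<psi>" by (auto simp: restrict_cochain_def)
qed

text \<open>
  Exactness at the cohomology of \<open>K\<close>: a class that vanishes on the deletion comes from a relative
  cocycle. A primitive on the deletion, extended by zero, provides the correction term.
\<close>

lemma restrict_coboundary_decompose:
  assumes "simplicial K" "\<phi> \<in> alt_cocycles K n"
    and "restrict_cochain v \<phi> \<in> alt_coboundaries (deletion K v) n"
  shows "\<exists>\<omega> \<in> alt_cocycles K n. restrict_cochain v \<omega> = 0 \<and> \<phi> - \<omega> \<in> alt_coboundaries K n"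
proof -
  interpret R: Vector_Spaces.linear scale_fun scale_fun "restrict_cochain v"
    by (rule linear_restrict_cochain)
  have "\<exists>\<beta> \<in> alt_coboundaries K n. restrict_cochain v \<beta> = restrict_cochain v \<phi>"
  proof (cases n)
    case 0
    then show ?thesis using assms(3) by (simp add: alt_coboundaries_def R.zero)
  next
    case (Suc m)
    with assms(3) obtain \<psi> where \<psi>: "\<psi> \<in> alt_cochains (deletion K v) m"
      "restrict_cochain v \<phi> = alt_coboundary (deletion K v) \<psi>" by (auto simp: alt_coboundaries_def)
    note ext = extend_deletion_cochain[OF \<psi>(1)]
    have "restrict_cochain v (alt_coboundary K \<psi>) = restrict_cochain v \<phi>"
      using alt_coboundary_deletion[of K v \<psi>] ext(2) \<psi>(2) by simp
    then show ?thesis using ext(1) Suc by (auto simp: alt_coboundaries_def)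
  qed
  then obtain \<beta> where \<beta>: "\<beta> \<in> alt_coboundaries K n" "restrict_cochain v \<beta> = restrict_cochain v \<phi>" ..
  have "\<phi> - \<beta> \<in> alt_cocycles K n"
    using assms(2) \<beta>(1) alt_coboundaries_subset_cocycles[OF assms(1)] subspace_alt_cocycles
    by (blast intro: fun_space.subspace_diff)
  moreover have "restrict_cochain v (\<phi> - \<beta>) = 0" using \<beta>(2) by (simp add: R.diff)
  ultimately show ?thesis using \<beta>(1) by (intro bexI[of _ "\<phi> - \<beta>"]) auto
qed

text \<open>
  The part of the long exact sequence of the pair \<open>(K, deletion K v)\<close> that bounds the cohomology of
  \<open>K\<close>. Restriction to the deletion accounts for \<open>r\<close> generators; what it kills is represented by
  relative cocycles, and these are cocycles of the link in one degree less, accounting for \<open>s\<close>. In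
  degree \<open>0\<close> there are no nonzero relative cochains, which is why the link enters only for
  \<open>n = Suc m\<close>.
\<close>

lemma betti_le_remove_vertex:
  assumes "simplicial K" "betti_le (deletion K v) n r"
    and "\<And>m. n = Suc m \<Longrightarrow> betti_le (link K v) m s"
  shows "betti_le K n (r + s)"
proof -
  interpret R: Vector_Spaces.linear scale_fun scale_fun "restrict_cochain v"
    by (rule linear_restrict_cochain)
  interpret C: Vector_Spaces.linear scale_fun scale_fun "contract_cochain v"
    by (rule linear_contract_cochain)
  let ?Z = "alt_cocycles K n" and ?B = "alt_coboundaries K n"
  let ?W = "{\<phi> \<in> ?Z. restrict_cochain v \<phi> \<in> alt_coboundaries (deletion K v) n}"
  let ?R = "{\<phi> \<in> ?Z. restrict_cochain v \<phi> = 0}"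
  have "restrict_cochain v ` ?Z \<subseteq> alt_cocycles (deletion K v) n"
    unfolding alt_cocycles_def
    by (auto simp: restrict_cochain_in_cochains alt_coboundary_deletion R.zero)
  then have 1: "codim_le ?Z ?W r"
    by (rule codim_le_preimage[OF linear_restrict_cochain subspace_alt_cocycles
          subspace_alt_coboundaries _ assms(2)[unfolded betti_le_def]])
  have 2: "?W \<subseteq> fun_space.span (?R \<union> ?B)"
  proof
    fix \<phi> assume "\<phi> \<in> ?W"
    then obtain \<omega> where "\<omega> \<in> ?R" "\<phi> - \<omega> \<in> ?B"
      using restrict_coboundary_decompose[OF assms(1)] by blast
    then have "\<omega> + (\<phi> - \<omega>) \<in> fun_space.span (?R \<union> ?B)"
      by (intro fun_space.span_add fun_space.span_base) auto
    then show "\<phi> \<in> fun_space.span (?R \<union> ?B)" by simp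
  qed
  have "codim_le ?R ?B s"
  proof (cases n)
    case 0
    have "\<phi> = 0" if "\<phi> \<in> ?R" for \<phi>
    proof
      fix xs
      show "\<phi> xs = 0 xs"
      proof (cases "xs = []")
        case True
        moreover have "restrict_cochain v \<phi> xs = 0" using that by simp
        ultimately show ?thesis by (simp add: restrict_cochain_def)
      next
        case False
        then show ?thesis using that alt_cochains_support[of \<phi> K n xs] 0
          by (simp add: alt_cocycles_def)
      qed
    qed
    then have "?R \<subseteq> fun_space.span ?B" using fun_space.span_zero by fastforce
    then show ?thesis by (rule codim_le_span)
  next
    case (Suc m)
    have "?R = ?Z \<inter> {\<phi>. restrict_cochain v \<phi> = 0}" by auto
    then have "fun_space.subspace ?R"
      by (simp only: fun_space.subspace_inter[OF subspace_alt_cocycles R.subspace_kernel])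
    moreover have "contract_cochain v ` ?R \<subseteq> alt_cocycles (link K v) m"
    proof
      fix \<chi> assume "\<chi> \<in> contract_cochain v ` ?R"
      then obtain \<phi> where \<phi>: "\<phi> \<in> alt_cochains K (Suc m)" "alt_coboundary K \<phi> = 0"
        "restrict_cochain v \<phi> = 0" "\<chi> = contract_cochain v \<phi>"
        unfolding alt_cocycles_def Suc by auto
      have "- alt_coboundary (link K v) \<chi> = 0"
        using contract_alt_coboundary[OF \<phi>(3), of K] \<phi>(2,4) by (simp add: C.zero)
      then show "\<chi> \<in> alt_cocycles (link K v) m"
        unfolding alt_cocycles_def using contract_cochain_in_cochains[OF \<phi>(1)] \<phi>(4)
        by (simp only: neg_equal_0_iff_equal mem_Collect_eq)
    qed
    ultimately have "codim_le ?R {\<phi> \<in> ?R. contract_cochain v \<phi> \<in> alt_coboundaries (link K v) m} s"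
      by (rule codim_le_preimage[OF linear_contract_cochain _
            subspace_alt_coboundaries _ assms(3)[OF Suc, unfolded betti_le_def]])
    then show ?thesis
    proof (rule codim_le_mono)
      show "{\<phi> \<in> ?R. contract_cochain v \<phi> \<in> alt_coboundaries (link K v) m} \<subseteq> ?B"
        unfolding Suc by (auto intro: relative_cocycle_is_coboundary)
    qed
  qed
  from codim_le_trans[OF 1 this 2] have "codim_le ?Z ?B (r + s)" by auto
  then show ?thesis unfolding betti_le_def .
qed


section \<open>Quotients of function spaces as vector spaces\<close>

text \<open>
  This is the shape of the modules of cocycles, for which the quotient is compared with
  \<open>codim_le\<close>.
\<close>

definition function_module :: "('a \<Rightarrow> real) set \<Rightarrow> (real, 'a \<Rightarrow> real) module" where
  "function_module Z =
     \<lparr>carrier = Z, mult = undefined, one = undefined, zero = 0, add = (+), smult = scale_fun\<rparr>"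

definition coset :: "('a \<Rightarrow> real) set \<Rightarrow> ('a \<Rightarrow> real) \<Rightarrow> ('a \<Rightarrow> real) set" where
  "coset B \<phi> = (\<lambda>\<beta>. \<beta> + \<phi>) ` B"

lemma function_module_coset: "B +>\<^bsub>function_module Z\<^esub> \<phi> = coset B \<phi>"
  unfolding a_r_coset_def' coset_def function_module_def by auto

lemma coset_absorb:
  assumes "fun_space.subspace B" "\<beta> \<in> B"
  shows "coset B (\<beta> + \<phi>) = coset B \<phi>"
proof
  show "coset B (\<beta> + \<phi>) \<subseteq> coset B \<phi>"
    unfolding coset_def
  proof (rule image_subsetI)
    fix x assume "x \<in> B"
    then have "x + \<beta> \<in> B" using assms by (simp add: fun_space.subspace_add)
    then show "x + (\<beta> + \<phi>) \<in> (\<lambda>\<beta>. \<beta> + \<phi>) ` B" by (rule rev_image_eqI) (simp add: add.assoc)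
  qed
  show "coset B \<phi> \<subseteq> coset B (\<beta> + \<phi>)"
    unfolding coset_def
  proof (rule image_subsetI)
    fix x assume "x \<in> B"
    then have "x - \<beta> \<in> B" using assms by (simp add: fun_space.subspace_diff)
    then show "x + \<phi> \<in> (\<lambda>x. x + (\<beta> + \<phi>)) ` B" by (rule rev_image_eqI) (simp add: algebra_simps)
  qed
qed

context
  fixes Z B :: "('a \<Rightarrow> real) set"
  assumes Z: "fun_space.subspace Z" and B: "fun_space.subspace B" "B \<subseteq> Z"
begin

private abbreviation "Q \<equiv> quotient_module (function_module Z) B"

lemma quotient_carrier: "carrier Q = coset B ` Z"
  unfolding quotient_module_def A_RCOSETS_def' function_module_coset
  by (auto simp: function_module_def)

lemma coset_0: "coset B 0 = B"
  unfolding coset_def by simp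

lemma quotient_zero: "\<zero>\<^bsub>Q\<^esub> = coset B 0"
  by (simp add: quotient_module_def coset_0)

lemma quotient_add: "coset B \<phi> \<oplus>\<^bsub>Q\<^esub> coset B \<psi> = coset B (\<phi> + \<psi>)"
proof -
  have "coset B \<phi> \<oplus>\<^bsub>Q\<^esub> coset B \<psi> = {x + y | x y. x \<in> coset B \<phi> \<and> y \<in> coset B \<psi>}"
    by (auto simp: quotient_module_def set_add_def' function_module_def)
  also have "\<dots> = coset B (\<phi> + \<psi>)"
  proof (intro equalityI subsetI)
    fix z assume "z \<in> {x + y | x y. x \<in> coset B \<phi> \<and> y \<in> coset B \<psi>}"
    then obtain a b where ab: "a \<in> B" "b \<in> B" "z = (a + \<phi>) + (b + \<psi>)" unfolding coset_def by auto
    then have "a + b \<in> B" using B(1) by (simp add: fun_space.subspace_add)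
    then show "z \<in> coset B (\<phi> + \<psi>)" unfolding coset_def ab(3)
      by (rule rev_image_eqI) (simp add: algebra_simps)
  next
    fix z assume "z \<in> coset B (\<phi> + \<psi>)"
    then obtain a where a: "a \<in> B" "z = (a + \<phi>) + (0 + \<psi>)" unfolding coset_def by (auto simp: add.assoc)
    moreover have "0 \<in> B" using B(1) by (rule fun_space.subspace_0)
    ultimately show "z \<in> {x + y | x y. x \<in> coset B \<phi> \<and> y \<in> coset B \<psi>}"
      unfolding coset_def by blast
  qed
  finally show ?thesis .
qed

lemma quotient_smult: "c \<odot>\<^bsub>Q\<^esub> coset B \<phi> = coset B (scale_fun c \<phi>)"
proof -
  have "coset B (scale_fun c a) = coset B (scale_fun c \<phi>)" if a: "a \<in> coset B \<phi>" for a
  proof -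
    from a obtain b where b: "b \<in> B" "a = b + \<phi>" unfolding coset_def by auto
    have "scale_fun c b \<in> B" using B(1) b(1) by (simp add: fun_space.subspace_scale)
    from coset_absorb[OF B(1) this] show ?thesis unfolding b(2) fun_space.scale_right_distrib .
  qed
  moreover have "coset B \<phi> \<noteq> {}" unfolding coset_def using fun_space.subspace_0[OF B(1)] by auto
  moreover have "c \<odot>\<^bsub>Q\<^esub> coset B \<phi> = (\<Union>a\<in>coset B \<phi>. coset B (scale_fun c a))"
    unfolding quotient_module_def function_module_coset by (simp add: function_module_def)
  ultimately show ?thesis by simp
qed

lemma quotient_vectorspace: "vectorspace (class_ring :: real ring) Q"
proof -
  note Zc = fun_space.subspace_0[OF Z] fun_space.subspace_add[OF Z] fun_space.subspace_scale[OF Z]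
    fun_space.subspace_neg[OF Z]
  have "abelian_group Q"
  proof (rule abelian_groupI)
    fix x assume "x \<in> carrier Q"
    then obtain \<phi> where \<phi>: "\<phi> \<in> Z" "x = coset B \<phi>" unfolding quotient_carrier by auto
    have "coset B (- \<phi>) \<oplus>\<^bsub>Q\<^esub> x = \<zero>\<^bsub>Q\<^esub>" unfolding \<phi>(2) quotient_add quotient_zero by simp
    moreover have "coset B (- \<phi>) \<in> carrier Q" unfolding quotient_carrier using Zc(4) \<phi>(1) by blast
    ultimately show "\<exists>y\<in>carrier Q. y \<oplus>\<^bsub>Q\<^esub> x = \<zero>\<^bsub>Q\<^esub>" by blast
  qed (auto simp: quotient_carrier quotient_add quotient_zero Zc add.assoc add.commute add.left_commute)
  moreover have "cring (class_ring :: real ring)" by (rule class_cring.cring_axioms)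
  ultimately have "module (class_ring :: real ring) Q"
    by (intro moduleI)
      (auto simp: quotient_carrier quotient_add quotient_smult Zc fun_space.scale_left_distrib
        fun_space.scale_right_distrib)
  then show ?thesis unfolding vectorspace_def using class_field.field_axioms by blast
qed

text \<open>
  The elements of \<open>Z\<close> whose coset lies in the span of the cosets of \<open>A\<close> form a subspace that contains
  both \<open>A\<close> and \<open>B\<close>, hence all of \<open>Z\<close>.
\<close>

lemma quotient_dim_le:
  assumes "codim_le Z B r"
  shows "vectorspace.dim (class_ring :: real ring) Q \<le> r"
proof -
  interpret V: vectorspace "class_ring :: real ring" Q by (rule quotient_vectorspace)
  from assms obtain A where A: "A \<subseteq> Z" "finite A" "card A \<le> r" "Z \<subseteq> fun_space.span (A \<union> B)"
    unfolding codim_le_def by blast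
  let ?A = "coset B ` A"
  let ?S = "{z \<in> Z. coset B z \<in> V.span ?A}"
  have sub: "?A \<subseteq> carrier Q" unfolding quotient_carrier using A(1) by blast
  have span: "LinearCombinations.submodule class_ring (V.span ?A) Q"
    by (rule V.span_is_submodule[OF sub])
  note closed = LinearCombinations.submodule.m_closed[OF span]
    LinearCombinations.submodule.zero_closed[OF span]
    LinearCombinations.submodule.smult_closed[OF span]
  have "fun_space.subspace ?S"
  proof (rule fun_space.subspaceI)
    show "0 \<in> ?S" using fun_space.subspace_0[OF Z] closed(2) unfolding quotient_zero by simp
  next
    fix \<phi> \<psi> assume "\<phi> \<in> ?S" "\<psi> \<in> ?S"
    then show "\<phi> + \<psi> \<in> ?S"
      using fun_space.subspace_add[OF Z] closed(1)[of "coset B \<phi>" "coset B \<psi>"]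
      unfolding quotient_add by blast
  next
    fix c \<phi> assume "\<phi> \<in> ?S"
    then show "scale_fun c \<phi> \<in> ?S"
      using fun_space.subspace_scale[OF Z] closed(3)[of c "coset B \<phi>"]
      unfolding quotient_smult by simp
  qed
  moreover have "A \<union> B \<subseteq> ?S"
  proof -
    have "coset B \<beta> \<in> V.span ?A" if "\<beta> \<in> B" for \<beta>
      using coset_absorb[OF B(1) that, of 0] closed(2) unfolding quotient_zero by simp
    then show ?thesis using A(1) B(2) V.in_own_span[OF sub] by blast
  qed
  ultimately have "fun_space.span (A \<union> B) \<subseteq> ?S" by (rule fun_space.span_minimal[rotated])
  then have "carrier Q \<subseteq> V.span ?A" using A(4) unfolding quotient_carrier by blast
  then have "V.gen_set ?A" using V.span_is_subset2[OF sub] by blast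
  then have "V.dim \<le> card ?A" using A(2) sub by (intro V.gen_ge_dim) auto
  also have "\<dots> \<le> r" using card_image_le[OF A(2), of "coset B"] A(3) by linarith
  finally show ?thesis .
qed

end


section \<open>Cohomology in terms of alternating cochains\<close>

text \<open>
  For fixed \<open>\<phi>\<close> these permutations are closed under composition, so it is enough to treat adjacent
  transpositions.
\<close>

definition antisymmetric_under :: "nat \<Rightarrow> ('a list \<Rightarrow> real) \<Rightarrow> (nat \<Rightarrow> nat) \<Rightarrow> bool" where
  "antisymmetric_under n \<phi> p \<longleftrightarrow> p permutes {..<n} \<and>
     (\<forall>xs. length xs = n \<longrightarrow> \<phi> (permute_list p xs) = of_int (sign p) * \<phi> xs)"

lemma antisymmetric_under_compose:
  assumes "antisymmetric_under n \<phi> p" "antisymmetric_under n \<phi> q"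
  shows "antisymmetric_under n \<phi> (p \<circ> q)"
proof -
  have pq: "p permutes {..<n}" "q permutes {..<n}" using assms unfolding antisymmetric_under_def by auto
  then have "permutation p" "permutation q" by (auto intro: permutes_imp_permutation)
  then have sign: "sign (p \<circ> q) = sign p * sign q" by (rule sign_compose)
  have "\<phi> (permute_list (p \<circ> q) xs) = of_int (sign (p \<circ> q)) * \<phi> xs" if "length xs = n" for xs
  proof -
    have "permute_list (p \<circ> q) xs = permute_list q (permute_list p xs)"
      using pq(2) that by (intro permute_list_compose) simp
    then show ?thesis using assms that sign unfolding antisymmetric_under_def by simp
  qed
  then show ?thesis using pq unfolding antisymmetric_under_def by (simp add: permutes_compose)
qed

lemma permute_list_adjacent:
  assumes "length us = i"
  shows "permute_list (Transposition.transpose i (Suc i)) (us @ x # y # ws) = us @ y # x # ws"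
proof (rule nth_equalityI)
  fix j assume "j < length (permute_list (Transposition.transpose i (Suc i)) (us @ x # y # ws))"
  then show "permute_list (Transposition.transpose i (Suc i)) (us @ x # y # ws) ! j =
      (us @ y # x # ws) ! j"
    using assms
    by (auto simp: permute_list_def nth_append transpose_def nth_Cons' simp del: upt_Suc)
qed simp

lemma antisymmetric_under_adjacent:
  assumes "alternating \<phi>" "Suc i < n"
  shows "antisymmetric_under n \<phi> (Transposition.transpose i (Suc i))"
proof -
  have "Transposition.transpose i (Suc i) permutes {..<n}"
    using assms(2) by (intro permutes_swap_id) auto
  moreover have "\<phi> (permute_list (Transposition.transpose i (Suc i)) xs) = - \<phi> xs" if "length xs = n" for xs
  proof -
    have "xs = take i xs @ xs ! i # xs ! Suc i # drop (Suc (Suc i)) xs"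
      using assms(2) that by (simp add: Cons_nth_drop_Suc)
    moreover have "length (take i xs) = i" using assms(2) that by simp
    ultimately have "\<exists>us x y ws. xs = us @ x # y # ws \<and> length us = i" by (intro exI conjI)
    then obtain us x y ws where xs: "xs = us @ x # y # ws" "length us = i" by (elim exE conjE)
    show ?thesis
      unfolding xs(1) permute_list_adjacent[OF xs(2)] by (rule alternatingD[OF assms(1)])
  qed
  ultimately show ?thesis unfolding antisymmetric_under_def by (simp add: sign_swap_id)
qed

lemma antisymmetric_under_id: "antisymmetric_under n \<phi> id"
  unfolding antisymmetric_under_def by (simp add: permutes_id sign_id)

lemma alternating_antisymmetric:
  assumes "alternating \<phi>" "p permutes {..<n}"
  shows "antisymmetric_under n \<phi> p"
  using finite_lessThan assms(2)
proof (induction rule: permutes_rev_induct)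
  case id
  show ?case by (rule antisymmetric_under_id)
next
  case (swap a b p)
  have adj: "antisymmetric_under n \<phi> (apply_adj_transps js)" if "\<forall>j\<in>set js. Suc j < n" for js
    using that
  proof (induction js)
    case (Cons j js)
    then show ?case
      unfolding apply_adj_transps_Cons Suc_eq_plus1[symmetric]
      by (intro antisymmetric_under_compose antisymmetric_under_adjacent[OF assms(1)]) simp_all
  qed (simp only: apply_adj_transps_Nil antisymmetric_under_id)
  have "antisymmetric_under n \<phi> (Transposition.transpose c d)" if "c < d" "d < n" for c d
    using adj[of "adj_transp_seq c d"] that
    by (simp add: adj_transp_seq_correct set_adj_transp_seq)
  then have "antisymmetric_under n \<phi> (Transposition.transpose a b)"
    using swap.hyps by (metis lessThan_iff linorder_neqE_nat transpose_commute)
  then show ?case by (rule antisymmetric_under_compose[OF swap.IH])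
qed

lemma cochains_eq_alt_cochains: "cochains K k = alt_cochains K (Suc k)"
proof (intro equalityI subsetI)
  fix \<phi> :: "'a list \<Rightarrow> real" assume \<phi>: "\<phi> \<in> alt_cochains K (Suc k)"
  from alternating_antisymmetric[OF alt_cochains_alternating[OF this]]
  show "\<phi> \<in> cochains K k"
    using alt_cochains_support[OF \<phi>]
    unfolding cochains_def ordered_simplices_def antisymmetric_under_def by auto
next
  fix \<phi> :: "'a list \<Rightarrow> real" assume \<phi>: "\<phi> \<in> cochains K k"
  then have supp: "\<phi> xs = 0" if "xs \<notin> ordered_simplices K k" for xs
    using that unfolding cochains_def by blast
  have "\<phi> (us @ x # y # ws) = - \<phi> (us @ y # x # ws)" for us x y ws
  proof (cases "us @ y # x # ws \<in> ordered_simplices K k")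
    case True
    let ?t = "Transposition.transpose (length us) (Suc (length us))"
    have "?t permutes {..<Suc k}"
      using True by (intro permutes_swap_id) (auto simp: ordered_simplices_def)
    then have "\<phi> (permute_list ?t (us @ y # x # ws)) = of_int (sign ?t) * \<phi> (us @ y # x # ws)"
      using \<phi> True unfolding cochains_def by blast
    then show ?thesis by (simp add: permute_list_adjacent sign_swap_id)
  next
    case False
    moreover have "us @ x # y # ws \<in> ordered_simplices K k \<longleftrightarrow> us @ y # x # ws \<in> ordered_simplices K k"
      by (auto simp: ordered_simplices_def insert_commute)
    ultimately show ?thesis using supp by simp
  qed
  then have "alternating \<phi>" unfolding alternating_def by blast
  then show "\<phi> \<in> alt_cochains K (Suc k)"
    using supp unfolding alt_cochains_def ordered_simplices_def by blast
qed

lemma coboundary_eq_alt_coboundary: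
  assumes "\<phi> \<in> alt_cochains K (Suc k)"
  shows "coboundary K k \<phi> = alt_coboundary K \<phi>"
proof
  fix xs
  show "coboundary K k \<phi> xs = alt_coboundary K \<phi> xs"
  proof (cases "length xs = Suc (Suc k)")
    case True
    then show ?thesis
      by (simp add: coboundary_def alt_coboundary_def ordered_simplices_def face_sum_conv_sum
          lessThan_Suc_atMost del: sum.atMost_Suc sum.lessThan_Suc)
  next
    case False
    then have "alt_coboundary K \<phi> xs = 0"
      using alt_cochains_support[OF alt_coboundary_in_cochains[OF assms]] by blast
    with False show ?thesis by (simp add: coboundary_def ordered_simplices_def)
  qed
qed

lemma cocycles_eq_alt_cocycles: "cocycles K k = alt_cocycles K (Suc k)"
  unfolding cocycles_def alt_cocycles_def cochains_eq_alt_cochains zero_fun_def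
  using coboundary_eq_alt_coboundary by fastforce

text \<open>
  For \<open>k = 0\<close> the right-hand side consists of coboundaries of cochains on the empty simplex, and these
  are zero because \<open>K\<close> is not augmented.
\<close>

lemma coboundaries_eq_alt_coboundaries:
  assumes "{} \<notin> K"
  shows "coboundaries K k = alt_coboundaries K (Suc k)"
proof (cases k)
  case 0
  have "\<phi> = 0" if "\<phi> \<in> alt_cochains K 0" for \<phi>
    using alt_cochains_support[OF that] assms by (auto simp: fun_eq_iff)
  then have "alt_cochains K 0 = {0}"
    using fun_space.subspace_0[OF subspace_alt_cochains[of K 0]] by blast
  moreover have "alt_coboundary K 0 = 0" using alt_coboundary_diff[of K "0 :: _ \<Rightarrow> real" 0] by simp
  ultimately show ?thesis using 0 by (simp add: coboundaries_def alt_coboundaries_def zero_fun_def)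
next
  case (Suc j)
  have "coboundary K j ` alt_cochains K (Suc j) = alt_coboundary K ` alt_cochains K (Suc j)"
    by (rule image_cong) (simp_all add: coboundary_eq_alt_coboundary)
  then show ?thesis
    using Suc by (simp add: coboundaries_def alt_coboundaries_def cochains_eq_alt_cochains)
qed

lemma cocycle_space_eq_function_module: "cocycle_space K k = function_module (cocycles K k)"
  unfolding cocycle_space_def function_module_def
  by (simp add: fun_eq_iff zero_fun_def)

lemma simplicial_whitney_complex: "simplicial (whitney_complex G)"
  unfolding simplicial_def whitney_complex_def by blast

lemma betti_number_le:
  assumes "betti_le (whitney_complex G) (Suc k) r"
  shows "betti_number G k \<le> r"
proof -
  have "{} \<notin> whitney_complex G" by (simp add: whitney_complex_def)
  note eqs = coboundaries_eq_alt_coboundaries[OF this] cocycles_eq_alt_cocycles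
    cocycle_space_eq_function_module
  show ?thesis
    unfolding betti_number_def cohomology_def eqs
    by (intro quotient_dim_le subspace_alt_cocycles subspace_alt_coboundaries
        alt_coboundaries_subset_cocycles simplicial_whitney_complex
        assms[unfolded betti_le_def])
qed


section \<open>Contractible graphs and spheres\<close>

text \<open>
  Its cohomology is the reduced cohomology of the graph. Augmentation makes the link of a vertex a complex
  of the same kind, namely the augmented complex of the unit sphere, even if that sphere is empty.
\<close>

definition augmented_complex :: "('a, 'b) pre_digraph \<Rightarrow> 'a set set" where
  "augmented_complex G = insert {} (whitney_complex G)"

lemma simplicial_augmented_complex: "simplicial (augmented_complex G)"
  using simplicial_whitney_complex[of G] unfolding augmented_complex_def simplicial_def by auto

lemma dominates_induce_subgraph_iff: "u \<rightarrow>\<^bsub>G \<restriction> S\<^esub> v \<longleftrightarrow> u \<in> S \<and> v \<in> S \<and> u \<rightarrow>\<^bsub>G\<^esub> v"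
  unfolding arcs_ends_def by (auto simp: arc_to_ends_def)

lemma augmented_complex_iff:
  "s \<in> augmented_complex G \<longleftrightarrow> s \<subseteq> verts G \<and> (\<forall>u \<in> s. \<forall>v \<in> s. u \<noteq> v \<longrightarrow> u \<rightarrow>\<^bsub>G\<^esub> v)"
  unfolding augmented_complex_def whitney_complex_def by auto

lemma augmented_complex_induce_subgraph:
  assumes "S \<subseteq> verts G"
  shows "augmented_complex (G \<restriction> S) = {s \<in> augmented_complex G. s \<subseteq> S}"
proof -
  have "s \<subseteq> verts G" if "s \<subseteq> S" for s using that assms by blast
  then show ?thesis
    unfolding set_eq_iff mem_Collect_eq augmented_complex_iff dominates_induce_subgraph_iff
      induce_subgraph_verts by blast
qed

lemma deletion_augmented_complex:
  "deletion (augmented_complex G) v = augmented_complex (G \<restriction> (verts G - {v}))"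
  unfolding augmented_complex_induce_subgraph[OF Diff_subset] deletion_def
  by (auto simp: augmented_complex_iff)

lemma graph_neighbours:
  assumes "graph G"
  shows "u \<rightarrow>\<^bsub>G\<^esub> v \<Longrightarrow> u \<in> verts G \<and> v \<in> verts G \<and> u \<noteq> v \<and> v \<rightarrow>\<^bsub>G\<^esub> u"
proof -
  interpret graph G by (rule assms)
  assume "u \<rightarrow>\<^bsub>G\<^esub> v"
  moreover from this have "v \<rightarrow>\<^bsub>G\<^esub> u" using sym_arcs unfolding symmetric_def by (meson symD)
  ultimately show ?thesis by (auto dest: adj_in_verts adj_not_same)
qed

lemma verts_unit_sphere: "verts (unit_sphere G v) = {y. v \<rightarrow>\<^bsub>G\<^esub> y}"
  by (simp add: unit_sphere_def)

lemma insert_simplex_iff: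
  assumes "graph G" "v \<in> verts G"
  shows "v \<notin> s \<and> insert v s \<in> augmented_complex G \<longleftrightarrow>
    s \<in> augmented_complex G \<and> s \<subseteq> verts (unit_sphere G v)"
proof
  assume "v \<notin> s \<and> insert v s \<in> augmented_complex G"
  then show "s \<in> augmented_complex G \<and> s \<subseteq> verts (unit_sphere G v)"
    unfolding verts_unit_sphere by (auto simp: augmented_complex_iff)
next
  assume s: "s \<in> augmented_complex G \<and> s \<subseteq> verts (unit_sphere G v)"
  then have "u \<noteq> v \<and> v \<rightarrow>\<^bsub>G\<^esub> u \<and> u \<rightarrow>\<^bsub>G\<^esub> v" if "u \<in> s" for u
    using that graph_neighbours[OF assms(1), of v u] by (auto simp: verts_unit_sphere)
  then show "v \<notin> s \<and> insert v s \<in> augmented_complex G"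
    using s assms(2) by (auto simp: augmented_complex_iff)
qed

lemma link_augmented_complex:
  assumes "graph G" "v \<in> verts G"
  shows "link (augmented_complex G) v = augmented_complex (unit_sphere G v)"
proof -
  have "{y. v \<rightarrow>\<^bsub>G\<^esub> y} \<subseteq> verts G" using graph_neighbours[OF assms(1)] by blast
  from augmented_complex_induce_subgraph[OF this] insert_simplex_iff[OF assms]
  show ?thesis unfolding link_def unit_sphere_def by auto
qed

lemma betti_le_augmented_remove_vertex:
  assumes "graph G" "v \<in> verts G" "betti_le (augmented_complex (G \<restriction> (verts G - {v}))) n r"
    and "\<And>m. n = Suc m \<Longrightarrow> betti_le (augmented_complex (unit_sphere G v)) m s"
  shows "betti_le (augmented_complex G) n (r + s)"
  using assms(3,4)
  by (intro betti_le_remove_vertex[where v = v] simplicial_augmented_complex)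
    (simp_all add: deletion_augmented_complex link_augmented_complex[OF assms(1,2)])

lemma betti_le_0I:
  assumes "\<And>\<phi>. \<phi> \<in> alt_cocycles K n \<Longrightarrow> \<phi> \<in> alt_coboundaries K n"
  shows "betti_le K n r"
  unfolding betti_le_def using assms fun_space.span_superset by (intro codim_le_span) blast

lemma betti_le_trivial:
  assumes "\<And>\<phi>. \<phi> \<in> alt_cocycles K n \<Longrightarrow> \<phi> = 0"
  shows "betti_le K n r"
proof (rule betti_le_0I)
  fix \<phi> assume "\<phi> \<in> alt_cocycles K n"
  then have "\<phi> = 0" by (rule assms)
  then show "\<phi> \<in> alt_coboundaries K n"
    using fun_space.subspace_0[OF subspace_alt_coboundaries] by simp
qed

text \<open>
  The coboundary maps the cochains on the empty simplex isomorphically to those on the only vertex.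
\<close>

lemma betti_le_one_vertex:
  assumes "verts G = {v}"
  shows "betti_le (augmented_complex G) n 0"
proof -
  let ?K = "augmented_complex G"
  have "s \<in> ?K \<longleftrightarrow> s = {} \<or> s = {v}" for s
    using assms by (auto simp: augmented_complex_iff subset_singleton_iff)
  then have K: "?K = {{}, {v}}" by blast
  have small: "xs = [] \<or> xs = [v]" if "distinct xs" "set xs \<in> ?K" for xs
  proof -
    have "card (set xs) \<le> 1" using that(2) K by auto
    then have "length xs \<le> 1" using distinct_card[OF that(1)] by simp
    then show ?thesis using that(2) K by (cases xs) auto
  qed
  have d: "\<phi> [] = 0" if "\<phi> \<in> alt_cocycles ?K n" for \<phi>
  proof -
    have "alt_coboundary ?K \<phi> [v] = 0" using that by (simp add: alt_cocycles_def)
    then show ?thesis by (simp add: alt_coboundary_def K)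
  qed
  show ?thesis
  proof (rule betti_le_0I)
    fix \<phi> assume \<phi>: "\<phi> \<in> alt_cocycles ?K n"
    then have \<phi>': "\<phi> \<in> alt_cochains ?K n" by (simp add: alt_cocycles_def)
    show "\<phi> \<in> alt_coboundaries ?K n"
    proof (cases "n = 1")
      case True
      define \<psi> :: "'a list \<Rightarrow> real" where "\<psi> xs = (if xs = [] then \<phi> [v] else 0)" for xs
      have "\<psi> \<in> alt_cochains ?K 0"
        unfolding alt_cochains_def alternating_def \<psi>_def K by simp
      moreover have "\<phi> xs = alt_coboundary ?K \<psi> xs" for xs
      proof (cases "xs = [v]")
        case False
        then have "\<phi> xs = 0"
          using alt_cochains_support[OF \<phi>', of xs] small[of xs] True by fastforce
        moreover have "alt_coboundary ?K \<psi> xs = 0"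
          using small[of xs] False unfolding alt_coboundary_def by auto
        ultimately show ?thesis by simp
      qed (simp add: alt_coboundary_def K \<psi>_def)
      then have "\<phi> = alt_coboundary ?K \<psi>" by (rule ext)
      ultimately show ?thesis using True by (auto simp: alt_coboundaries_def)
    next
      case False
      have "\<phi> xs = 0" for xs
        using alt_cochains_support[OF \<phi>', of xs] small[of xs] False d[OF \<phi>] by fastforce
      then have "\<phi> = 0" by (simp add: fun_eq_iff)
      then show ?thesis using fun_space.subspace_0[OF subspace_alt_coboundaries] by simp
    qed
  qed
qed

lemma betti_le_contractible:
  assumes "contractible_graph G"
  shows "betti_le (augmented_complex G) n 0"
  using assms
proof (induction arbitrary: n)
  case (one_vertex G v)
  then show ?case by (intro betti_le_one_vertex)
next
  case (remove_vertex G v)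
  from betti_le_augmented_remove_vertex[OF remove_vertex.hyps(1,2) remove_vertex.IH(2,1)]
  show ?case by simp
qed

text \<open>
  The empty graph is the \<open>(-1)\<close>-sphere: its augmented complex has the empty simplex only, and the
  constant on it is a cocycle in degree \<open>0\<close> without primitive.
\<close>

lemma betti_le_empty_sphere:
  assumes "verts G = {}"
  shows "betti_le (augmented_complex G) n (if n = 0 then 1 else 0)"
proof -
  let ?K = "augmented_complex G"
  have K: "?K = {{}}" using assms by (auto simp: augmented_complex_iff)
  show ?thesis
  proof (cases "n = 0")
    case True
    define \<epsilon> :: "'a list \<Rightarrow> real" where "\<epsilon> xs = (if xs = [] then 1 else 0)" for xs
    have "\<epsilon> \<in> alt_cochains ?K 0"
      unfolding alt_cochains_def alternating_def \<epsilon>_def K by simp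
    moreover have "alt_coboundary ?K \<epsilon> = 0"
      by (rule ext) (auto simp: alt_coboundary_def K)
    ultimately have "\<epsilon> \<in> alt_cocycles ?K n" using True by (simp add: alt_cocycles_def)
    moreover have "alt_cocycles ?K n \<subseteq> fun_space.span ({\<epsilon>} \<union> alt_coboundaries ?K n)"
    proof
      fix \<phi> assume "\<phi> \<in> alt_cocycles ?K n"
      then have "\<phi> \<in> alt_cochains ?K 0" using True by (simp add: alt_cocycles_def)
      from alt_cochains_support[OF this] have "\<phi> = scale_fun (\<phi> []) \<epsilon>"
        by (auto simp: \<epsilon>_def fun_eq_iff)
      also have "\<dots> \<in> fun_space.span ({\<epsilon>} \<union> alt_coboundaries ?K n)"
        by (intro fun_space.span_scale fun_space.span_base) simp
      finally show "\<phi> \<in> fun_space.span ({\<epsilon>} \<union> alt_coboundaries ?K n)" .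
    qed
    ultimately show ?thesis using True unfolding betti_le_def codim_le_def
      by (intro exI[of _ "{\<epsilon>}"]) simp
  next
    case False
    have "\<phi> = 0" if "\<phi> \<in> alt_cocycles ?K n" for \<phi>
    proof
      fix xs
      have "\<phi> \<in> alt_cochains ?K n" using that by (simp add: alt_cocycles_def)
      from alt_cochains_support[OF this, of xs] False show "\<phi> xs = 0 xs" by (auto simp: K)
    qed
    then show ?thesis by (rule betti_le_trivial)
  qed
qed

text \<open>
  An \<open>m\<close>-sphere minus a suitable vertex is contractible and contributes nothing, so the cohomology of
  the sphere is bounded by that of an \<open>(m - 1)\<close>-dimensional unit sphere one degree lower.
\<close>

lemma betti_le_sphere:
  assumes "evako_sphere m G"
  shows "betti_le (augmented_complex G) n (if int n = m + 1 then 1 else 0)"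
proof -
  let ?P = "\<lambda>m (G :: ('a, 'b) pre_digraph). \<forall>n.
    betti_le (augmented_complex G) n (if int n = m + 1 then 1 else 0)"
  have "(evako_graph k G \<longrightarrow> 0 \<le> k \<and> graph G \<and> (\<forall>x \<in> verts G. ?P (k - 1) (unit_sphere G x))) \<and>
    (evako_sphere m G \<longrightarrow> ?P m G)" for k m and G :: "('a, 'b) pre_digraph"
  proof (induction rule: evako_graph_evako_sphere.induct)
    case (evako_graph k G)
    then show ?case by blast
  next
    case (empty_sphere G)
    then show ?case using betti_le_empty_sphere[of G] by simp
  next
    case (evako_sphere k G x)
    show ?case
    proof
      fix n
      let ?r = "if int n = k + 1 then 1 else 0 :: nat"
      have "betti_le (augmented_complex G) n (0 + ?r)"
      proof (rule betti_le_augmented_remove_vertex)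
        show "graph G" "x \<in> verts G" using evako_sphere by auto
        show "betti_le (augmented_complex (G \<restriction> (verts G - {x}))) n 0"
          using evako_sphere by (intro betti_le_contractible) auto
        fix m assume "n = Suc m"
        then show "betti_le (augmented_complex (unit_sphere G x)) m ?r"
          using evako_sphere by (auto split: if_splits dest!: spec[of _ m])
      qed
      then show "betti_le (augmented_complex G) n ?r" by simp
    qed
  qed
  with assms show ?thesis by blast
qed


section \<open>Sublevel sets of a Morse function\<close>

lemma morse_index_eq:
  assumes "evako_sphere m (lower_sphere G f x)"
  shows "morse_index G f x = m + 1"
proof -
  have "(THE m. evako_sphere m (lower_sphere G f x)) = m"
    using assms evako_sphere_dim_unique by (intro the_equality) auto
  then show ?thesis unfolding morse_index_def by simp
qed

text \<open>
  When \<open>x\<close> has the largest value in \<open>W\<close> and \<open>W\<close> contains everything below \<open>x\<close>, local injectivity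
  makes the neighbours of \<open>x\<close> in \<open>W\<close> the neighbours with smaller value.
\<close>

lemma link_sublevel:
  assumes "graph G" "x \<in> W" "W \<subseteq> verts G"
    and "\<And>y. y \<in> W \<Longrightarrow> f y \<le> f x" "\<And>y. y \<in> verts G \<Longrightarrow> f y < f x \<Longrightarrow> y \<in> W"
    and "\<And>y. x \<rightarrow>\<^bsub>G\<^esub> y \<Longrightarrow> f x \<noteq> f y"
  shows "link {s \<in> whitney_complex G. s \<subseteq> W} x = augmented_complex (lower_sphere G f x)"
proof -
  let ?L = "{y \<in> verts (unit_sphere G x). f y < f x}"
  have x: "x \<in> verts G" using assms(2,3) by blast
  have "?L \<subseteq> verts G" using graph_neighbours[OF assms(1)] by (auto simp: verts_unit_sphere)
  then have lower: "augmented_complex (lower_sphere G f x) = {s \<in> augmented_complex G. s \<subseteq> ?L}"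
    unfolding lower_sphere_def by (rule augmented_complex_induce_subgraph)
  have sphere: "?L = verts (unit_sphere G x) \<inter> W"
  proof
    show "?L \<subseteq> verts (unit_sphere G x) \<inter> W" using assms(5) \<open>?L \<subseteq> verts G\<close> by blast
    show "verts (unit_sphere G x) \<inter> W \<subseteq> ?L"
      using assms(4,6) by (force simp: verts_unit_sphere order.strict_iff_order)
  qed
  have ins: "insert x s \<in> whitney_complex G \<and> insert x s \<subseteq> W \<longleftrightarrow>
      insert x s \<in> augmented_complex G \<and> s \<subseteq> W" for s
    using assms(2) by (auto simp: augmented_complex_def)
  have "s \<in> link {s \<in> whitney_complex G. s \<subseteq> W} x \<longleftrightarrow> s \<in> augmented_complex (lower_sphere G f x)" for s
    unfolding link_def mem_Collect_eq ins lower sphere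
    using insert_simplex_iff[OF assms(1) x, of s] by blast
  then show ?thesis by blast
qed

text \<open>
  Sets \<open>W\<close> closed under passing to smaller values arise by adding vertices in order of increasing \<open>f\<close>,
  with ties broken arbitrarily. The complexes are not augmented, so that they compute the
  unreduced cohomology, and \<open>Suc k\<close> counts the vertices of a \<open>k\<close>-simplex. A vertex \<open>x\<close> whose lower
  sphere is an \<open>m\<close>-sphere contributes to \<open>H\<^sup>k\<close> only if \<open>k = m + 1\<close>, which is its Morse index.
\<close>

lemma betti_le_sublevel:
  assumes "graph G" "morse_function G f" "finite W" "W \<subseteq> verts G"
    and "\<And>x y. x \<in> W \<Longrightarrow> y \<in> verts G \<Longrightarrow> f y < f x \<Longrightarrow> y \<in> W"
  shows "betti_le {s \<in> whitney_complex G. s \<subseteq> W} (Suc k) (card {x \<in> W. morse_index G f x = int k})"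
  using assms(3-5)
proof (induction W rule: finite_ranking_induct[where f = f])
  case empty
  have "{s \<in> whitney_complex G. s \<subseteq> {}} = {}" by (auto simp: whitney_complex_def)
  moreover have "\<phi> = 0" if "\<phi> \<in> alt_cocycles {} (Suc k)" for \<phi> :: "'a list \<Rightarrow> real"
    using that by (auto simp: alt_cocycles_def alt_cochains_def fun_eq_iff)
  ultimately show ?case by (simp only:) (rule betti_le_trivial)
next
  case (insert x W)
  show ?case
  proof (cases "x \<in> W")
    case True
    then show ?thesis using insert by (simp add: insert_absorb)
  next
    case False
    let ?K = "{s \<in> whitney_complex G. s \<subseteq> insert x W}"
    let ?c = "\<lambda>W. card {x \<in> W. morse_index G f x = int k}"
    have x: "x \<in> verts G" using insert.prems(1) by simp
    from assms(2) x obtain m where m: "evako_sphere m (lower_sphere G f x)"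
      unfolding morse_function_def by blast
    have link: "link ?K x = augmented_complex (lower_sphere G f x)"
    proof (rule link_sublevel[OF assms(1) _ insert.prems(1)])
      show "f y \<le> f x" if "y \<in> insert x W" for y using insert.hyps(2) that by auto
      show "y \<in> insert x W" if "y \<in> verts G" "f y < f x" for y using insert.prems(2) that by blast
      show "f x \<noteq> f y" if "x \<rightarrow>\<^bsub>G\<^esub> y" for y using assms(2) that unfolding morse_function_def by blast
    qed simp
    have del: "deletion ?K x = {s \<in> whitney_complex G. s \<subseteq> W}"
      using False unfolding deletion_def by blast
    have "y \<in> W" if "z \<in> W" "y \<in> verts G" "f y < f z" for z y
      using insert.prems(2)[of z y] insert.hyps(2)[of z] that by fastforce
    then have IH: "betti_le (deletion ?K x) (Suc k) (?c W)"
      unfolding del using insert.IH insert.prems(1) by blast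
    have "simplicial ?K"
      using simplicial_whitney_complex[of G] unfolding simplicial_def by blast
    then have "betti_le ?K (Suc k) (?c W + (if int k = m + 1 then 1 else 0))"
      by (rule betti_le_remove_vertex[OF _ IH]) (simp only: link nat.inject betti_le_sphere[OF m])
    moreover have "?c (insert x W) = ?c W + (if int k = m + 1 then 1 else 0)"
    proof (cases "int k = m + 1")
      case True
      then have "{y \<in> insert x W. morse_index G f y = int k} =
          insert x {y \<in> W. morse_index G f y = int k}"
        using morse_index_eq[OF m] by auto
      then show ?thesis using True False insert.hyps(1) by simp
    next
      case ne: False
      then have "{y \<in> insert x W. morse_index G f y = int k} = {y \<in> W. morse_index G f y = int k}"
        using morse_index_eq[OF m] by auto
      then show ?thesis using ne by simp
    qed
    ultimately show ?thesis by simp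
  qed
qed

theorem proposition3:
  fixes G :: "('a, 'b) pre_digraph" and f :: "'a \<Rightarrow> real"
  assumes "graph G" and "morse_function G f"
  shows "\<forall>k. betti_number G k \<le> critical_count G f k"
proof
  fix k
  interpret graph G by (rule assms(1))
  have "{s \<in> whitney_complex G. s \<subseteq> verts G} = whitney_complex G"
    by (auto simp: whitney_complex_def)
  with betti_le_sublevel[OF assms finite_verts order_refl, of k]
  have "betti_le (whitney_complex G) (Suc k) (critical_count G f k)"
    unfolding critical_count_def by simp
  then show "betti_number G k \<le> critical_count G f k" by (rule betti_number_le)
qed

end
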